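(* Let $0<a<b<\infty$, $\alpha>0$, $\rho>0$. Let $f:[a,b]\to\mathbb{R}$ be a differentiable mapping on $(a,b)$, with one-sided derivatives $f'(a)$, $f'(b)$ at the endpoints, and with $f'\in L[a,b]$. Put $F(x)=f(x)+f(a+b-x)$ for $x\in[a,b]$. Then $F$ is also differentiable and $F'\in L[a,b]$. If $|f'|$ is convex on $[a,b]$, then $$ \left| \frac{F(a)+F(b)}{2} - \frac{\rho^\alpha \Gamma(\alpha+1)}{2(b^\rho-a^\rho)^\alpha}\left[ {}^\rho I^\alpha_{a+}F(b)+ {}^\rho I^\alpha_{b-}F(a)\right] \right| \leq \frac{b-a}{2(b^\rho-a^\rho)^\alpha} \left(\int_0^1 |K(t)|\,dt\right) \big( |f'(a)| + |f'(b)|\big), $$ where $K(t) = [((1-t)a + bt)^\rho - a^\rho]^\alpha - [b^\rho-((1-t)a + bt)^\rho]^\alpha$.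
   Context: The left- and right-sided Katugampola fractional integrals of order $\alpha>0$ with parameter $\rho>0$ are $$ {}^\rho I^\alpha_{a+}h(x)=\frac{\rho^{1-\alpha}}{\Gamma(\alpha)}\int_a^x\frac{t^{\rho-1}}{(x^\rho-t^\rho)^{1-\alpha}}h(t)\,dt,\qquad {}^\rho I^\alpha_{b-}h(x)=\frac{\rho^{1-\alpha}}{\Gamma(\alpha)}\int_x^b\frac{t^{\rho-1}}{(t^\rho-x^\rho)^{1-\alpha}}h(t)\,dt,$$ when the integrals exist; ${}^\rho I^\alpha_{a+}h(b)$ and ${}^\rho I^\alpha_{b-}h(a)$ denote their values at $x=b$ and $x=a$ respectively. $\Gamma$ is Euler's gamma function and $L[a,b]$ is the space of Lebesgue integrable functions on $[a,b]$. *)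

theory Defs
  imports "HOL-Analysis.Analysis"
begin

text \<open>
  In both operators the singular endpoint \<open>t = x\<close> of the kernel is a null set, so the value that
  totalised \<open>powr\<close> and division assign there does not matter. The \<open>_integrable\<close> predicates say that
  the integrals exist; otherwise the Bochner integral is \<open>0\<close> by convention.
\<close>

definition katugampola_left_integrable ::
    "real \<Rightarrow> real \<Rightarrow> real \<Rightarrow> (real \<Rightarrow> real) \<Rightarrow> real \<Rightarrow> bool" where
  "katugampola_left_integrable \<rho> \<alpha> a h x \<longleftrightarrow>
     (\<lambda>t. t powr (\<rho> - 1) / (x powr \<rho> - t powr \<rho>) powr (1 - \<alpha>) * h t)
       absolutely_integrable_on {a..x}"

definition katugampola_left ::
    "real \<Rightarrow> real \<Rightarrow> real \<Rightarrow> (real \<Rightarrow> real) \<Rightarrow> real \<Rightarrow> real" where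
  "katugampola_left \<rho> \<alpha> a h x =
     \<rho> powr (1 - \<alpha>) / Gamma \<alpha> *
     (LINT t:{a..x}|lebesgue. t powr (\<rho> - 1) / (x powr \<rho> - t powr \<rho>) powr (1 - \<alpha>) * h t)"

definition katugampola_right_integrable ::
    "real \<Rightarrow> real \<Rightarrow> real \<Rightarrow> (real \<Rightarrow> real) \<Rightarrow> real \<Rightarrow> bool" where
  "katugampola_right_integrable \<rho> \<alpha> b h x \<longleftrightarrow>
     (\<lambda>t. t powr (\<rho> - 1) / (t powr \<rho> - x powr \<rho>) powr (1 - \<alpha>) * h t)
       absolutely_integrable_on {x..b}"

definition katugampola_right ::
    "real \<Rightarrow> real \<Rightarrow> real \<Rightarrow> (real \<Rightarrow> real) \<Rightarrow> real \<Rightarrow> real" where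
  "katugampola_right \<rho> \<alpha> b h x =
     \<rho> powr (1 - \<alpha>) / Gamma \<alpha> *
     (LINT t:{x..b}|lebesgue. t powr (\<rho> - 1) / (t powr \<rho> - x powr \<rho>) powr (1 - \<alpha>) * h t)"

end

theory Submission
  imports Defs
begin

text \<open>
  The two kernels are, up to the factor \<open>\<alpha> * \<rho>\<close>, the derivatives of \<open>- (b powr \<rho> - x powr \<rho>) powr \<alpha>\<close>
  and \<open>(x powr \<rho> - a powr \<rho>) powr \<alpha>\<close>. These are continuous up to the endpoints, so integrating
  by parts turns the left-hand side into \<open>1 / (2 * D)\<close> times the integral of \<open>G * F'\<close>, where
  \<open>D = (b powr \<rho> - a powr \<rho>) powr \<alpha>\<close> and \<open>G\<close> is the sum of the two antiderivatives, that is, \<open>K\<close>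
  transported to \<open>{a..b}\<close>. Convexity of \<open>\<bar>f'\<bar>\<close> gives \<open>\<bar>F' x\<bar> \<le> \<bar>f' x\<bar> + \<bar>f' (a + b - x)\<bar> \<le> \<bar>f' a\<bar> + \<bar>f' b\<bar>\<close>.
\<close>

text \<open>Continuity on a compact interval makes the first factor bounded and measurable, and such
  a factor preserves absolute integrability.\<close>

lemma absolutely_integrable_mult_continuous_left:
  fixes G h :: "real \<Rightarrow> real"
  assumes "continuous_on {a..b} G" and "h absolutely_integrable_on {a..b}"
  shows "(\<lambda>x. G x * h x) absolutely_integrable_on {a..b}"
proof (rule absolutely_integrable_bounded_measurable_product_real)
  show "G \<in> borel_measurable (lebesgue_on {a..b})"
    by (intro continuous_imp_measurable_on_sets_lebesgue assms) auto
  show "bounded (G ` {a..b})"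
    by (intro compact_imp_bounded compact_continuous_image assms compact_Icc)
qed (use assms in auto)

text \<open>Here \<open>g\<close> stands for a kernel that may blow up at an endpoint when \<alpha>
  < 1. Hence \<open>G\<close> is differentiated only in the open interval and is merely continuous
  at the ends, which is all that the interior forms of the fundamental theorem and of integration by
  parts require.\<close>

lemma absolutely_integrable_by_parts:
  fixes G g u u' :: "real \<Rightarrow> real"
  assumes "a \<le> b" and contG: "continuous_on {a..b} G"
    and derG: "\<And>x. x \<in> {a<..<b} \<Longrightarrow> (G has_real_derivative g x) (at x)"
    and g_nonneg: "\<And>x. x \<in> {a..b} \<Longrightarrow> 0 \<le> g x"
    and deru: "\<And>x. x \<in> {a..b} \<Longrightarrow> (u has_real_derivative u' x) (at x within {a..b})"
    and u': "u' absolutely_integrable_on {a..b}"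
  shows "(\<lambda>x. g x * u x) absolutely_integrable_on {a..b}"
    and "integral {a..b} (\<lambda>x. g x * u x) = G b * u b - G a * u a - integral {a..b} (\<lambda>x. G x * u' x)"
proof -
  have contu: "continuous_on {a..b} u"
    using deru by (meson DERIV_continuous continuous_on_eq_continuous_within)
  have deru_int: "(u has_real_derivative u' x) (at x)" if "x \<in> {a<..<b}" for x
    using deru[of x] that at_within_Icc_at[of a x b] by auto
  txt \<open>A nonnegative derivative is absolutely integrable, even when it is unbounded near an endpoint.\<close>
  have "(g has_integral G b - G a) {a..b}"
    using derG by (intro fundamental_theorem_of_calculus_interior assms)
      (simp add: has_real_derivative_iff_has_vector_derivative)
  then have "g absolutely_integrable_on {a..b}"
    using g_nonneg by (intro nonnegative_absolutely_integrable_1) auto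
  from absolutely_integrable_mult_continuous_left[OF contu this]
  show "(\<lambda>x. g x * u x) absolutely_integrable_on {a..b}"
    by (simp add: mult.commute)
  have "(\<lambda>x. G x * u' x) integrable_on {a..b}"
    by (intro set_lebesgue_integral_eq_integral(1) absolutely_integrable_mult_continuous_left contG u')
  then have "((\<lambda>x. G x * u' x) has_integral integral {a..b} (\<lambda>x. G x * u' x)) {a..b}"
    by (rule integrable_integral)
  then have "((\<lambda>x. g x * u x) has_integral
      G b * u b - G a * u a - integral {a..b} (\<lambda>x. G x * u' x)) {a..b}"
    using derG deru_int
    by (intro integration_by_parts_interior[OF bounded_bilinear_mult \<open>a \<le> b\<close> contG contu])
      (simp_all add: has_real_derivative_iff_has_vector_derivative)
  then show "integral {a..b} (\<lambda>x. g x * u x) =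
      G b * u b - G a * u a - integral {a..b} (\<lambda>x. G x * u' x)"
    by (rule integral_unique)
qed

text \<open>The powers of \<rho> combine to \<rho>, and the functional equation of Gamma leaves the
  factor \<alpha>. The product \<alpha> * \<rho> is exactly the denominator in the antiderivatives
  of the kernels below.\<close>

lemma katugampola_constant:
  fixes \<rho> \<alpha> :: real
  assumes "0 < \<rho>" and "0 < \<alpha>"
  shows "\<rho> powr \<alpha> * Gamma (\<alpha> + 1) * (\<rho> powr (1 - \<alpha>) / Gamma \<alpha> * x) = \<alpha> * \<rho> * x"
proof -
  have "\<rho> powr \<alpha> * \<rho> powr (1 - \<alpha>) = \<rho>"
    using assms by (simp flip: powr_add)
  moreover have "Gamma (\<alpha> + 1) = \<alpha> * Gamma \<alpha>"
    using assms by (intro Gamma_plus1) auto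
  moreover have "Gamma \<alpha> \<noteq> 0"
    using Gamma_real_pos[OF \<open>0 < \<alpha>\<close>] by linarith
  ultimately show ?thesis
    by (simp add: field_simps)
qed

text \<open>The antiderivative \<open>G\<close> of the kernel vanishes at \<open>b\<close>, so only
  the boundary term at \<open>a\<close> survives.\<close>

lemma katugampola_left_by_parts:
  fixes u u' :: "real \<Rightarrow> real"
  assumes "0 < a" and "a \<le> b" and "0 < \<alpha>" and "0 < \<rho>"
    and deru: "\<And>x. x \<in> {a..b} \<Longrightarrow> (u has_real_derivative u' x) (at x within {a..b})"
    and u': "u' absolutely_integrable_on {a..b}"
  shows "katugampola_left_integrable \<rho> \<alpha> a u b"
    and "\<rho> powr \<alpha> * Gamma (\<alpha> + 1) * katugampola_left \<rho> \<alpha> a u b =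
      (b powr \<rho> - a powr \<rho>) powr \<alpha> * u a
      + integral {a..b} (\<lambda>x. (b powr \<rho> - x powr \<rho>) powr \<alpha> * u' x)"
proof -
  define k where "k = (\<lambda>t. t powr (\<rho> - 1) / (b powr \<rho> - t powr \<rho>) powr (1 - \<alpha>))"
  \<comment> \<open>By the chain rule, \<open>(b powr \<rho> - x powr \<rho>) powr \<alpha>\<close>
    has derivative -\<alpha> * \<rho> times the kernel, whence the sign and the denominator.\<close>
  define G where "G = (\<lambda>x. - ((b powr \<rho> - x powr \<rho>) powr \<alpha>) / (\<alpha> * \<rho>))"
  have contG: "continuous_on {a..b} G"
    unfolding G_def using assms
    \<comment> \<open>At x = \<open>b\<close> the base of the outer power is 0; continuity there
      rests on \<alpha> > 0.\<close>
    by (intro continuous_intros continuous_on_powr') (auto intro: powr_mono2)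
  have derG: "(G has_real_derivative k x) (at x)" if "x \<in> {a<..<b}" for x
  proof -
    \<comment> \<open>Strictness keeps the base of the outer power positive, where
      \<open>powr\<close> is differentiable.\<close>
    have "x powr \<rho> < b powr \<rho>"
      using that assms by (intro powr_less_mono2) auto
    then show ?thesis
      unfolding G_def k_def using that assms
      by (auto intro!: derivative_eq_intros simp: powr_diff field_simps)
  qed
  have "0 \<le> k x" for x
    by (simp add: k_def)
  note parts = absolutely_integrable_by_parts[OF \<open>a \<le> b\<close> contG derG this deru u']
  show "katugampola_left_integrable \<rho> \<alpha> a u b"
    using parts(1) by (simp add: katugampola_left_integrable_def k_def)
  have "\<rho> powr \<alpha> * Gamma (\<alpha> + 1) * katugampola_left \<rho> \<alpha> a u b = \<alpha> * \<rho> * integral {a..b} (\<lambda>x. k x * u x)"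
    using assms set_lebesgue_integral_eq_integral(2)[OF parts(1)]
    unfolding katugampola_left_def katugampola_constant[OF \<open>0 < \<rho>\<close> \<open>0 < \<alpha>\<close>] by (simp add: k_def)
  also have "\<dots> = \<alpha> * \<rho> * (G b * u b - G a * u a) - integral {a..b} (\<lambda>x. \<alpha> * \<rho> * (G x * u' x))"
    using parts(2) by (simp add: right_diff_distrib)
  also have "(\<lambda>x. \<alpha> * \<rho> * (G x * u' x)) = (\<lambda>x. - ((b powr \<rho> - x powr \<rho>) powr \<alpha> * u' x))"
    using assms by (auto simp: G_def)
  also have "\<alpha> * \<rho> * (G b * u b - G a * u a) = (b powr \<rho> - a powr \<rho>) powr \<alpha> * u a"
    using assms by (simp add: G_def)
  finally show "\<rho> powr \<alpha> * Gamma (\<alpha> + 1) * katugampola_left \<rho> \<alpha> a u b =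
      (b powr \<rho> - a powr \<rho>) powr \<alpha> * u a
      + integral {a..b} (\<lambda>x. (b powr \<rho> - x powr \<rho>) powr \<alpha> * u' x)"
    by simp
qed

text \<open>Mirror image of the left-sided case: the antiderivative now increases from 0 at
  \<open>a\<close>, so the boundary term sits at \<open>b\<close> and the remaining integral changes
  sign.\<close>

lemma katugampola_right_by_parts:
  fixes u u' :: "real \<Rightarrow> real"
  assumes "0 < a" and "a \<le> b" and "0 < \<alpha>" and "0 < \<rho>"
    and deru: "\<And>x. x \<in> {a..b} \<Longrightarrow> (u has_real_derivative u' x) (at x within {a..b})"
    and u': "u' absolutely_integrable_on {a..b}"
  shows "katugampola_right_integrable \<rho> \<alpha> b u a"
    and "\<rho> powr \<alpha> * Gamma (\<alpha> + 1) * katugampola_right \<rho> \<alpha> b u a =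
      (b powr \<rho> - a powr \<rho>) powr \<alpha> * u b
      - integral {a..b} (\<lambda>x. (x powr \<rho> - a powr \<rho>) powr \<alpha> * u' x)"
proof -
  define k where "k = (\<lambda>t. t powr (\<rho> - 1) / (t powr \<rho> - a powr \<rho>) powr (1 - \<alpha>))"
  define G where "G = (\<lambda>x. (x powr \<rho> - a powr \<rho>) powr \<alpha> / (\<alpha> * \<rho>))"
  have contG: "continuous_on {a..b} G"
    unfolding G_def using assms
    by (intro continuous_intros continuous_on_powr') (auto intro: powr_mono2)
  have derG: "(G has_real_derivative k x) (at x)" if "x \<in> {a<..<b}" for x
  proof -
    have "a powr \<rho> < x powr \<rho>"
      using that assms by (intro powr_less_mono2) auto
    then show ?thesis
      unfolding G_def k_def using that assms
      by (auto intro!: derivative_eq_intros simp: powr_diff field_simps)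
  qed
  have "0 \<le> k x" for x
    by (simp add: k_def)
  note parts = absolutely_integrable_by_parts[OF \<open>a \<le> b\<close> contG derG this deru u']
  show "katugampola_right_integrable \<rho> \<alpha> b u a"
    using parts(1) by (simp add: katugampola_right_integrable_def k_def)
  have "\<rho> powr \<alpha> * Gamma (\<alpha> + 1) * katugampola_right \<rho> \<alpha> b u a = \<alpha> * \<rho> * integral {a..b} (\<lambda>x. k x * u x)"
    using assms set_lebesgue_integral_eq_integral(2)[OF parts(1)]
    unfolding katugampola_right_def katugampola_constant[OF \<open>0 < \<rho>\<close> \<open>0 < \<alpha>\<close>] by (simp add: k_def)
  also have "\<dots> = \<alpha> * \<rho> * (G b * u b - G a * u a) - integral {a..b} (\<lambda>x. \<alpha> * \<rho> * (G x * u' x))"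
    using parts(2) by (simp add: right_diff_distrib)
  also have "(\<lambda>x. \<alpha> * \<rho> * (G x * u' x)) = (\<lambda>x. (x powr \<rho> - a powr \<rho>) powr \<alpha> * u' x)"
    using assms by (auto simp: G_def)
  also have "\<alpha> * \<rho> * (G b * u b - G a * u a) = (b powr \<rho> - a powr \<rho>) powr \<alpha> * u b"
    using assms by (simp add: G_def)
  finally show "\<rho> powr \<alpha> * Gamma (\<alpha> + 1) * katugampola_right \<rho> \<alpha> b u a =
      (b powr \<rho> - a powr \<rho>) powr \<alpha> * u b
      - integral {a..b} (\<lambda>x. (x powr \<rho> - a powr \<rho>) powr \<alpha> * u' x)" .
qed

text \<open>Reflection maps the interval injectively onto itself with derivative of modulus 1, so
  the change of variables formula applies. This handles the summand of F' that involves f' at a + b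
  - x.\<close>

lemma absolutely_integrable_reflect_Icc:
  fixes h :: "real \<Rightarrow> real"
  assumes "h absolutely_integrable_on {a..b}"
  shows "(\<lambda>x. h (a + b - x)) absolutely_integrable_on {a..b}"
proof -
  have "(\<lambda>x. a + b - x) ` {a..b} = {a..b}"
    by simp
  moreover have "((\<lambda>x. a + b - x) has_real_derivative -1) (at x within {a..b})" for x
    by (auto intro!: derivative_eq_intros)
  ultimately show ?thesis
    using assms has_absolute_integral_change_of_variables_1'
      [of "{a..b}" "\<lambda>x. a + b - x" "\<lambda>_. -1" h "integral {a..b} h"]
    by (auto simp: inj_on_def)
qed

text \<open>Affine substitution with Jacobian b - a. It produces the factor b - a of the final bound
  when an integral over \<open>{a..b}\<close> is rewritten in terms of \<open>K\<close>.\<close>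

lemma set_integral_unit_interval:
  fixes h :: "real \<Rightarrow> real"
  assumes "a < b" and h: "h absolutely_integrable_on {a..b}"
  shows "(b - a) * (LINT t:{0..1}|lebesgue. h ((1 - t) * a + b * t)) = integral {a..b} h"
proof -
  define g where "g = (\<lambda>t. (1 - t) * a + b * t)"
  have g: "g = (\<lambda>t. (b - a) * t + a)"
    by (auto simp: g_def algebra_simps)
  have "g ` {0..1} = {a..b}"
    using \<open>a < b\<close> unfolding g by (subst image_affinity_atLeastAtMost) auto
  moreover have "(g has_real_derivative (b - a)) (at t within {0..1})" for t
    unfolding g by (auto intro!: derivative_eq_intros)
  moreover have "inj_on g {0..1}"
    using \<open>a < b\<close> by (auto simp: g inj_on_def)
  ultimately have "(\<lambda>t. (b - a) * h (g t)) absolutely_integrable_on {0..1} \<and>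
      integral {0..1} (\<lambda>t. (b - a) * h (g t)) = integral {a..b} h"
    using h \<open>a < b\<close> has_absolute_integral_change_of_variables_1'
      [of "{0..1}" g "\<lambda>_. b - a" h "integral {a..b} h"]
    by auto
  then show ?thesis
    using set_lebesgue_integral_eq_integral(2)[of "{0..1}" "\<lambda>t. (b - a) * h (g t)"]
    by (simp add: g_def)
qed

text \<open>The points x and a + b - x are convex combinations of the endpoints with interchanged
  weights. In the sum of the two convexity inequalities each endpoint value therefore has total
  weight 1.\<close>

lemma convex_on_add_reflect_le:
  fixes h :: "real \<Rightarrow> real"
  assumes "convex_on {a..b} h" and "x \<in> {a..b}"
  shows "h x + h (a + b - x) \<le> h a + h b"
proof (cases "a = b")
  case True
  then show ?thesis using assms by auto
next
  case False
  \<comment> \<open>The weight of \<open>b\<close> in x; the division is why a = b is treated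
    separately.\<close>
  define t where "t = (x - a) / (b - a)"
  have t: "0 \<le> t" "t \<le> 1" and "t * (b - a) = x - a"
    using assms(2) False by (auto simp: t_def field_simps)
  then have x: "x = (1 - t) * a + t * b" and y: "a + b - x = (1 - t) * b + t * a"
    by (simp_all add: algebra_simps)
  have "h x \<le> (1 - t) * h a + t * h b"
    using convex_onD[OF assms(1) t, of a b] assms(2) by (simp add: x)
  moreover have "h (a + b - x) \<le> (1 - t) * h b + t * h a"
    using convex_onD[OF assms(1) t, of b a] assms(2) by (simp add: y)
  ultimately show ?thesis
    by (simp add: algebra_simps)
qed

theorem theorem3p5:
  fixes a b \<alpha> \<rho> :: real and f f' F K :: "real \<Rightarrow> real"
  assumes "0 < a" and "a < b" and "\<alpha> > 0" and "\<rho> > 0"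
    and "\<And>x. x \<in> {a..b} \<Longrightarrow> (f has_real_derivative f' x) (at x within {a..b})"
    and "f' absolutely_integrable_on {a..b}"
    and "\<And>x. x \<in> {a..b} \<Longrightarrow> F x = f x + f (a + b - x)"
    and "\<And>t. t \<in> {0..1} \<Longrightarrow>
           K t = (((1 - t) * a + b * t) powr \<rho> - a powr \<rho>) powr \<alpha>
               - (b powr \<rho> - ((1 - t) * a + b * t) powr \<rho>) powr \<alpha>"
  shows "(\<exists>F'. (\<forall>x\<in>{a..b}. (F has_real_derivative F' x) (at x within {a..b})) \<and>
               F' absolutely_integrable_on {a..b}) \<and>
         (convex_on {a..b} (\<lambda>x. \<bar>f' x\<bar>) \<longrightarrow>
            katugampola_left_integrable \<rho> \<alpha> a F b \<and>
            katugampola_right_integrable \<rho> \<alpha> b F a \<and>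
            \<bar>(F a + F b) / 2
              - \<rho> powr \<alpha> * Gamma (\<alpha> + 1) / (2 * (b powr \<rho> - a powr \<rho>) powr \<alpha>)
                * (katugampola_left \<rho> \<alpha> a F b + katugampola_right \<rho> \<alpha> b F a)\<bar>
            \<le> (b - a) / (2 * (b powr \<rho> - a powr \<rho>) powr \<alpha>)
                * (LINT t:{0..1}|lebesgue. \<bar>K t\<bar>) * (\<bar>f' a\<bar> + \<bar>f' b\<bar>))"
proof -
  \<comment> \<open>The minus sign comes from the derivative -1 of the reflection.\<close>
  define F' where "F' = (\<lambda>x. f' x - f' (a + b - x))"
  define D where "D = (b powr \<rho> - a powr \<rho>) powr \<alpha>"
  define G where "G = (\<lambda>x. (x powr \<rho> - a powr \<rho>) powr \<alpha> - (b powr \<rho> - x powr \<rho>) powr \<alpha>)"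
  have "D > 0"
    using assms(1-4) powr_less_mono2[of \<rho> a b] by (simp add: D_def)
  have derF: "(F has_real_derivative F' x) (at x within {a..b})" if "x \<in> {a..b}" for x
  \<comment> \<open>\<open>F\<close> is prescribed only on \<open>{a..b}\<close>, so the derivative
    is computed for the explicit sum and transferred. The two agree on the whole interval, so any
    positive radius serves, here 1.\<close>
  proof (rule has_field_derivative_transform_within[OF _ zero_less_one that])
    \<comment> \<open>The image of \<open>{a..b}\<close> under the reflection is
      \<open>{a..b}\<close> itself; writing it as an image fits the chain rule for derivatives
      within a set and covers the one-sided derivatives at the endpoints.\<close>
    have "(f has_real_derivative f' (a + b - x)) (at (a + b - x) within (\<lambda>x. a + b - x) ` {a..b})"
      using assms(5)[of "a + b - x"] that by auto
    moreover have "((\<lambda>x. a + b - x) has_real_derivative -1) (at x within {a..b})"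
      by (auto intro!: derivative_eq_intros)
    ultimately have "((\<lambda>x. f (a + b - x)) has_real_derivative f' (a + b - x) * - 1) (at x within {a..b})"
      by (rule DERIV_image_chain[unfolded o_def])
    then show "((\<lambda>x. f x + f (a + b - x)) has_real_derivative F' x) (at x within {a..b})"
      using assms(5)[OF that] by (auto simp: F'_def intro!: derivative_eq_intros)
  qed (use assms(7) in auto)
  have F'_int: "F' absolutely_integrable_on {a..b}"
    unfolding F'_def by (intro set_integral_diff assms(6) absolutely_integrable_reflect_Icc)
  have contL: "continuous_on {a..b} (\<lambda>x. (b powr \<rho> - x powr \<rho>) powr \<alpha>)"
   and contR: "continuous_on {a..b} (\<lambda>x. (x powr \<rho> - a powr \<rho>) powr \<alpha>)"
    using assms(1-4) by (intro continuous_intros continuous_on_powr'; auto intro: powr_mono2)+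
  then have contG: "continuous_on {a..b} G"
    unfolding G_def by (intro continuous_on_diff)
  note int = set_lebesgue_integral_eq_integral(1)[OF absolutely_integrable_mult_continuous_left]
  note left = katugampola_left_by_parts[OF assms(1) less_imp_le[OF assms(2)] assms(3,4) derF F'_int]
  note right = katugampola_right_by_parts[OF assms(1) less_imp_le[OF assms(2)] assms(3,4) derF F'_int]
  have bound: "\<bar>(F a + F b) / 2
      - \<rho> powr \<alpha> * Gamma (\<alpha> + 1) / (2 * D) * (katugampola_left \<rho> \<alpha> a F b + katugampola_right \<rho> \<alpha> b F a)\<bar>
      \<le> (b - a) / (2 * D) * (LINT t:{0..1}|lebesgue. \<bar>K t\<bar>) * (\<bar>f' a\<bar> + \<bar>f' b\<bar>)"
    if convex: "convex_on {a..b} (\<lambda>x. \<bar>f' x\<bar>)"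
  proof -
    define M where "M = \<bar>f' a\<bar> + \<bar>f' b\<bar>"
    have "integral {a..b} (\<lambda>x. G x * F' x) =
        integral {a..b} (\<lambda>x. (x powr \<rho> - a powr \<rho>) powr \<alpha> * F' x)
        - integral {a..b} (\<lambda>x. (b powr \<rho> - x powr \<rho>) powr \<alpha> * F' x)"
      unfolding G_def left_diff_distrib
      by (intro integral_diff int contL contR F'_int)
    \<comment> \<open>The left integral supplies the boundary term D * F a, the right one D * F b;
      their remaining integrals combine to minus the integral of G * F'.\<close>
    then have "\<rho> powr \<alpha> * Gamma (\<alpha> + 1) * (katugampola_left \<rho> \<alpha> a F b + katugampola_right \<rho> \<alpha> b F a)
        = D * (F a + F b) - integral {a..b} (\<lambda>x. G x * F' x)"
      using left(2) right(2) by (simp add: D_def algebra_simps)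
    then have eq: "(F a + F b) / 2
        - \<rho> powr \<alpha> * Gamma (\<alpha> + 1) / (2 * D) * (katugampola_left \<rho> \<alpha> a F b + katugampola_right \<rho> \<alpha> b F a)
        = integral {a..b} (\<lambda>x. G x * F' x) / (2 * D)"
      \<comment> \<open>Moving the division outward first exposes the product that the preceding
        identity evaluates.\<close>
      using \<open>D > 0\<close> by (simp only: times_divide_eq_left) (simp add: diff_divide_distrib)
    have G_int: "(\<lambda>x. \<bar>G x\<bar>) absolutely_integrable_on {a..b}"
      using contG by (intro absolutely_integrable_continuous_real continuous_intros)
    have "\<bar>integral {a..b} (\<lambda>x. G x * F' x)\<bar> \<le> integral {a..b} (\<lambda>x. \<bar>G x\<bar> * M)"
      unfolding real_norm_def[symmetric]
    proof (rule integral_norm_bound_integral)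
      show "(\<lambda>x. G x * F' x) integrable_on {a..b}"
        by (intro int contG F'_int)
      show "(\<lambda>x. norm (G x) * M) integrable_on {a..b}"
        using set_lebesgue_integral_eq_integral(1)[OF G_int] by (intro integrable_on_mult_left) simp
      show "norm (G x * F' x) \<le> norm (G x) * M" if "x \<in> {a..b}" for x
      proof -
        have "\<bar>F' x\<bar> \<le> M"
          using convex_on_add_reflect_le[OF convex that] by (simp add: F'_def M_def)
        then show ?thesis
          by (simp add: abs_mult mult_left_mono)
      qed
    qed
    also have "\<dots> = integral {a..b} (\<lambda>x. \<bar>G x\<bar>) * M"
      by simp
    also have "integral {a..b} (\<lambda>x. \<bar>G x\<bar>) = (b - a) * (LINT t:{0..1}|lebesgue. \<bar>G ((1 - t) * a + b * t)\<bar>)"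
      using set_integral_unit_interval[OF assms(2) G_int] by simp
    \<comment> \<open>On \<open>{0..1}\<close>, where \<open>K\<close> is prescribed, it equals
      \<open>G\<close> composed with the affine map.\<close>
    also have "(LINT t:{0..1}|lebesgue. \<bar>G ((1 - t) * a + b * t)\<bar>) = (LINT t:{0..1}|lebesgue. \<bar>K t\<bar>)"
      by (intro set_lebesgue_integral_cong) (auto simp: assms(8) G_def)
    finally show ?thesis
      unfolding eq M_def using \<open>D > 0\<close> by (simp add: divide_right_mono)
  qed
  show ?thesis
    using derF F'_int left(1) right(1) bound unfolding D_def by blast
qed

end
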